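(* Suppose that either $\beta\le\frac{\delta}{\mu}$, or $\frac{\delta}{\mu}<\beta\le\frac{2\delta}{\mu}$ and $M\le M_0(\beta)$. Consider the HJB equation $$0=\max_{\alpha\le a\le\beta}\left(\tfrac12\sigma^2a^2V''(x)+(a\mu-\delta)V'(x)-\gamma V(x)+M(1-V'(x))^+\right),\qquad V(0)=0,\qquad(\ast)$$ on $[0,\infty)$ together with the bounds $0\le V(x)\le\frac{M}{\gamma}$ for all $x>0$ $(\ast\ast)$. (i) If $M\ge M_\beta$, then $V(x)=\frac{M}{\gamma}\left(1-e^{\tilde r_-(\beta)x}\right)$, $x\ge0$, is a concave, twice continuously differentiable solution of $(\ast)$ satisfying $(\ast\ast)$. (ii) If $M_\alpha\le M<M_\beta$, then $V(x)=\frac{M}{\gamma}\left(1-\exp\left(-\frac{\mu}{\sigma^2\tilde c}x\right)\right)$, $x\ge0$, is a concave, twice continuously differentiable solution of $(\ast)$ satisfying $(\ast\ast)$. (iii) If $M<M_\alpha$, then $V(x)=\frac{M}{\gamma}\left(1-e^{\tilde r_-(\alpha)x}\right)$, $x\ge0$, is a concave, twice continuously differentiable solution of $(\ast)$ satisfying $(\ast\ast)$.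
   Context: Parameters: real constants $\mu>0$, $\sigma>0$, $\gamma>0$, $\delta\ge0$, $M>0$, $0<\alpha<\beta<\infty$; $y^+=\max(y,0)$. For $z>0$: $\tilde r_-(z)=\dfrac{-(z\mu-\delta-M)-\sqrt{(z\mu-\delta-M)^2+2\gamma\sigma^2z^2}}{\sigma^2z^2}$ and $M_z=\left(z-\dfrac{2\delta\mu}{\mu^2+2\gamma\sigma^2}\right)\dfrac{\mu^2+2\gamma\sigma^2}{2\mu}$. $\tilde c=\dfrac{2\mu(\delta+M)}{\mu^2+2\gamma\sigma^2}$; $M_0(\beta)=\dfrac{\sigma^2\beta^2\gamma}{2(\beta\mu-\delta)}$ for $\beta>\delta/\mu$. *)

theory Defs
  imports "HOL-Analysis.Analysis"
begin

definition r_minus :: "real \<Rightarrow> real \<Rightarrow> real \<Rightarrow> real \<Rightarrow> real \<Rightarrow> real \<Rightarrow> real" where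
  "r_minus \<mu> \<sigma> \<gamma> \<delta> M z =
     (- (z * \<mu> - \<delta> - M) - sqrt ((z * \<mu> - \<delta> - M)\<^sup>2 + 2 * \<gamma> * \<sigma>\<^sup>2 * z\<^sup>2)) / (\<sigma>\<^sup>2 * z\<^sup>2)"

definition M_threshold :: "real \<Rightarrow> real \<Rightarrow> real \<Rightarrow> real \<Rightarrow> real \<Rightarrow> real" where
  "M_threshold \<mu> \<sigma> \<gamma> \<delta> z =
     (z - 2 * \<delta> * \<mu> / (\<mu>\<^sup>2 + 2 * \<gamma> * \<sigma>\<^sup>2)) * ((\<mu>\<^sup>2 + 2 * \<gamma> * \<sigma>\<^sup>2) / (2 * \<mu>))"

definition c_tilde :: "real \<Rightarrow> real \<Rightarrow> real \<Rightarrow> real \<Rightarrow> real \<Rightarrow> real" where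
  "c_tilde \<mu> \<sigma> \<gamma> \<delta> M = 2 * \<mu> * (\<delta> + M) / (\<mu>\<^sup>2 + 2 * \<gamma> * \<sigma>\<^sup>2)"

text \<open>Only meaningful for \<open>\<delta> / \<mu> < \<beta>\<close>.\<close>

definition M_zero :: "real \<Rightarrow> real \<Rightarrow> real \<Rightarrow> real \<Rightarrow> real \<Rightarrow> real" where
  "M_zero \<mu> \<sigma> \<gamma> \<delta> \<beta> = \<sigma>\<^sup>2 * \<beta>\<^sup>2 * \<gamma> / (2 * (\<beta> * \<mu> - \<delta>))"

definition pos_part :: "real \<Rightarrow> real" where
  "pos_part y = max y 0"

text \<open>The derivative of a function on the half-line \<open>[0, \<infinity>)\<close>: two-sided at \<open>x > 0\<close>,
  one-sided at \<open>x = 0\<close>. Values of the function at negative arguments play no role.\<close>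

definition hderiv :: "(real \<Rightarrow> real) \<Rightarrow> real \<Rightarrow> real" where
  "hderiv f x = vector_derivative f (at x within {0..})"

definition C2_halfline :: "(real \<Rightarrow> real) \<Rightarrow> bool" where
  "C2_halfline V \<longleftrightarrow>
     V differentiable_on {0..} \<and> hderiv V differentiable_on {0..} \<and>
     continuous_on {0..} (hderiv (hderiv V))"

text \<open>\<open>Max\<close> is only defined for finite sets; here \<open>m\<close> is the attained maximum of \<open>F\<close> over \<open>S\<close>.\<close>

definition is_max_over :: "real \<Rightarrow> (real \<Rightarrow> real) \<Rightarrow> real set \<Rightarrow> bool" where
  "is_max_over m F S \<longleftrightarrow> (\<exists>a\<in>S. F a = m) \<and> (\<forall>a\<in>S. F a \<le> m)"

definition HJB_solution ::
    "real \<Rightarrow> real \<Rightarrow> real \<Rightarrow> real \<Rightarrow> real \<Rightarrow> real \<Rightarrow> real \<Rightarrow> (real \<Rightarrow> real) \<Rightarrow> bool" where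
  "HJB_solution \<mu> \<sigma> \<gamma> \<delta> M \<alpha> \<beta> V \<longleftrightarrow>
     (\<forall>x\<ge>0. is_max_over 0
        (\<lambda>a. 1 / 2 * \<sigma>\<^sup>2 * a\<^sup>2 * hderiv (hderiv V) x + (a * \<mu> - \<delta>) * hderiv V x
              - \<gamma> * V x + M * pos_part (1 - hderiv V x))
        {\<alpha>..\<beta>}) \<and>
     V 0 = 0"

definition HJB_bounds :: "real \<Rightarrow> real \<Rightarrow> (real \<Rightarrow> real) \<Rightarrow> bool" where
  "HJB_bounds \<gamma> M V \<longleftrightarrow> (\<forall>x>0. 0 \<le> V x \<and> V x \<le> M / \<gamma>)"

definition concave_C2_bounded_HJB_solution ::
    "real \<Rightarrow> real \<Rightarrow> real \<Rightarrow> real \<Rightarrow> real \<Rightarrow> real \<Rightarrow> real \<Rightarrow> (real \<Rightarrow> real) \<Rightarrow> bool" where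
  "concave_C2_bounded_HJB_solution \<mu> \<sigma> \<gamma> \<delta> M \<alpha> \<beta> V \<longleftrightarrow>
     concave_on {0..} V \<and> C2_halfline V \<and>
     HJB_solution \<mu> \<sigma> \<gamma> \<delta> M \<alpha> \<beta> V \<and> HJB_bounds \<gamma> M V"

end

theory Submission
  imports Defs
begin

text \<open>
  Every candidate has the form \<open>V x = M / \<gamma> * (1 - exp (r * x))\<close> with \<open>r < 0\<close>. For such a function
  \<open>V\<close>, \<open>V'\<close> and \<open>V''\<close> are affine in the same exponential, so as long as \<open>V' \<le> 1\<close>, which makes the
  positive part \<open>(1 - V')\<^sup>+\<close> equal to \<open>1 - V'\<close>, the expression under the maximum is
  \<open>- (M / \<gamma>) * exp (r * x) * P a\<close> with the quadratic
  \<open>P a = 1/2 * \<sigma>\<^sup>2 * a\<^sup>2 * r\<^sup>2 + (a * \<mu> - \<delta> - M) * r - \<gamma>\<close>, which does not depend on \<open>x\<close>. The HJB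
  equation thus reduces to two algebraic facts: \<open>P\<close> is nonnegative on \<open>[\<alpha>, \<beta>]\<close>, and it vanishes
  at some \<open>z\<close> there.

  The parabola \<open>P\<close> opens upwards and has its vertex at \<open>a\<^sup>* = - \<mu> / (\<sigma>\<^sup>2 * r)\<close>. Hence the optimal \<open>z\<close>
  is the point of \<open>[\<alpha>, \<beta>]\<close> closest to \<open>a\<^sup>*\<close>. Requiring that the vertex itself be a zero of \<open>P\<close> forces
  \<open>a\<^sup>* = c\<close>, where \<open>c\<close> is the constant \<open>c_tilde\<close>; this is the interior case. When \<open>c\<close> lies beyond an
  endpoint \<open>z\<close>, requiring \<open>P z = 0\<close> gives \<open>r = r_minus z\<close>, and one has to see that the vertex for
  this \<open>r\<close> lies on the same side of \<open>z\<close> as \<open>c\<close> (\<open>vertex_right_of_control\<close>,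
  \<open>vertex_left_of_control\<close>). The thresholds \<open>M_threshold z\<close> are just the values of \<open>M\<close> at which
  \<open>c\<close> crosses \<open>z\<close>.

  The remaining condition \<open>V' \<le> 1\<close> is where the hypothesis on \<open>\<beta>\<close> enters. As \<open>V'\<close> is decreasing, it
  amounts to \<open>V' 0 \<le> 1\<close>, and because of \<open>P z = 0\<close> this follows from
  \<open>(z * \<mu> - \<delta>) * M \<le> \<sigma>\<^sup>2 * z\<^sup>2 * \<gamma> / 2\<close>. At \<open>z = \<beta>\<close> this is the hypothesis, and it carries over to all
  smaller \<open>z\<close> because \<open>z\<^sup>2 / (z * \<mu> - \<delta>)\<close> decreases in \<open>z\<close> up to \<open>2 * \<delta> / \<mu>\<close>
  (\<open>drift_bound_below\<close>).
\<close>

section \<open>Derivatives on the half-line\<close>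

text \<open>Agreement is required only on \<open>{0..}\<close>, so that the rule can be applied a second time to
  \<open>hderiv f\<close>, which is known only there.\<close>

lemma hderiv_eqI:
  assumes "x \<ge> 0" and "\<And>y. y \<ge> 0 \<Longrightarrow> f y = g y"
    and "(g has_real_derivative d) (at x)"
  shows "hderiv f x = d"
proof -
  have "(g has_vector_derivative d) (at x within {0..})"
    using assms(3)
    by (simp add: has_real_derivative_iff_has_vector_derivative has_vector_derivative_at_within)
  then have "(f has_vector_derivative d) (at x within {0..})"
    by (rule has_vector_derivative_transform[rotated 2]) (use assms in auto)
  moreover have "at x within {0..} \<noteq> bot"
  proof -
    have "at_right x \<le> at x within {0..}"
      by (intro at_le) (use assms(1) in auto)
    moreover have "at_right x \<noteq> bot"
      by simp
    ultimately show ?thesis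
      by (metis bot.extremum_unique)
  qed
  ultimately show ?thesis
    unfolding hderiv_def by (rule vector_derivative_within[rotated])
qed

section \<open>Verification of the exponential ansatz\<close>

lemma exponential_concave:
  fixes c r :: real
  assumes "c \<ge> 0"
  shows "concave_on {0..} (\<lambda>x. c * (1 - exp (r * x)))"
proof (rule f''_le0_imp_concave)
  show "((\<lambda>x. c * (1 - exp (r * x))) has_real_derivative - (c * r * exp (r * x))) (at x)" for x
    by (auto intro!: derivative_eq_intros)
  show "((\<lambda>x. - (c * r * exp (r * x))) has_real_derivative - (c * r\<^sup>2 * exp (r * x))) (at x)" for x
    by (auto intro!: derivative_eq_intros simp: power2_eq_square)
qed (use assms in auto)

text \<open>The reduction of the HJB equation to the sign of the quadratic \<open>P\<close>. The hypothesis
  \<open>- M * r \<le> \<gamma>\<close> says that \<open>V' 0 \<le> 1\<close>.\<close>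

lemma exponential_solution:
  fixes \<mu> \<sigma> \<gamma> \<delta> M \<alpha> \<beta> r z :: real
  defines "P \<equiv> \<lambda>a. 1/2 * \<sigma>\<^sup>2 * a\<^sup>2 * r\<^sup>2 + (a * \<mu> - \<delta> - M) * r - \<gamma>"
  assumes pos: "\<gamma> > 0" "M > 0" and r: "r < 0" and slope: "- M * r \<le> \<gamma>"
    and z: "z \<in> {\<alpha>..\<beta>}" "P z = 0"
    and nonneg: "\<And>a. a \<in> {\<alpha>..\<beta>} \<Longrightarrow> P a \<ge> 0"
  shows "concave_C2_bounded_HJB_solution \<mu> \<sigma> \<gamma> \<delta> M \<alpha> \<beta> (\<lambda>x. M / \<gamma> * (1 - exp (r * x)))"
proof -
  define V where "V = (\<lambda>x. M / \<gamma> * (1 - exp (r * x)))"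
  define V1 where "V1 = (\<lambda>x. - (M / \<gamma> * r * exp (r * x)))"
  define V2 where "V2 = (\<lambda>x. - (M / \<gamma> * r\<^sup>2 * exp (r * x)))"
  have dV: "(V has_real_derivative V1 x) (at x)" for x
    unfolding V_def V1_def using pos by (auto intro!: derivative_eq_intros)
  have dV1: "(V1 has_real_derivative V2 x) (at x)" for x
    unfolding V1_def V2_def using pos by (auto intro!: derivative_eq_intros simp: power2_eq_square)
  have h1: "hderiv V x = V1 x" if "x \<ge> 0" for x
    by (rule hderiv_eqI[OF that refl dV])
  have h2: "hderiv (hderiv V) x = V2 x" if "x \<ge> 0" for x
    by (rule hderiv_eqI[OF that h1 dV1])
  have exp_le: "exp (r * x) \<le> 1" if "x \<ge> 0" for x
    using r that by (simp add: mult_nonpos_nonneg)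

  have C2: "C2_halfline V"
    unfolding C2_halfline_def
  proof (intro conjI)
    show "V differentiable_on {0..}"
      using dV by (meson differentiable_at_imp_differentiable_on real_differentiable_def)
    have "V1 differentiable_on {0..}"
      using dV1 by (meson differentiable_at_imp_differentiable_on real_differentiable_def)
    then show "hderiv V differentiable_on {0..}"
      unfolding differentiable_on_def
      by (metis atLeast_iff differentiable_transform_within h1 zero_less_one)
    have "continuous_on {0..} V2"
      unfolding V2_def by (intro continuous_intros)
    then show "continuous_on {0..} (hderiv (hderiv V))"
      by (rule continuous_on_eq) (simp add: h2)
  qed

  have V1_le: "V1 x \<le> 1" if "x \<ge> 0" for x
  proof -
    have "(- M * r) * exp (r * x) \<le> \<gamma> * 1"
      using slope exp_le[OF that] pos by (intro mult_mono) auto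
    then show ?thesis
      using pos by (simp add: V1_def field_simps)
  qed
  have F: "1 / 2 * \<sigma>\<^sup>2 * a\<^sup>2 * hderiv (hderiv V) x + (a * \<mu> - \<delta>) * hderiv V x
              - \<gamma> * V x + M * pos_part (1 - hderiv V x) = - (M / \<gamma> * exp (r * x) * P a)"
    if "x \<ge> 0" for a x
  proof -
    have "pos_part (1 - V1 x) = 1 - V1 x"
      using V1_le[OF that] by (simp add: pos_part_def)
    moreover have "1 / 2 * \<sigma>\<^sup>2 * a\<^sup>2 * V2 x + (a * \<mu> - \<delta>) * V1 x - \<gamma> * V x + M * (1 - V1 x)
        = - (M / \<gamma> * exp (r * x) * P a)"
      using pos unfolding V_def V1_def V2_def P_def by (simp add: field_simps power2_eq_square)
    ultimately show ?thesis
      by (simp only: h1[OF that] h2[OF that])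
  qed
  have "HJB_solution \<mu> \<sigma> \<gamma> \<delta> M \<alpha> \<beta> V"
    unfolding HJB_solution_def
  proof (intro conjI allI impI)
    show "V 0 = 0"
      by (simp add: V_def)
    fix x :: real
    assume x: "x \<ge> 0"
    show "is_max_over 0
        (\<lambda>a. 1 / 2 * \<sigma>\<^sup>2 * a\<^sup>2 * hderiv (hderiv V) x + (a * \<mu> - \<delta>) * hderiv V x
              - \<gamma> * V x + M * pos_part (1 - hderiv V x)) {\<alpha>..\<beta>}"
      unfolding is_max_over_def F[OF x]
    proof (intro conjI ballI bexI)
      show "- (M / \<gamma> * exp (r * x) * P z) = 0"
        using z(2) by simp
      show "- (M / \<gamma> * exp (r * x) * P a) \<le> 0" if "a \<in> {\<alpha>..\<beta>}" for a
        using nonneg[OF that] pos by simp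
    qed (rule z(1))
  qed
  moreover have "HJB_bounds \<gamma> M V"
    unfolding HJB_bounds_def
  proof (intro allI impI)
    fix x :: real
    assume "x > 0"
    then have "0 \<le> 1 - exp (r * x)" "1 - exp (r * x) \<le> 1"
      using exp_le[of x] by auto
    with pos show "0 \<le> V x \<and> V x \<le> M / \<gamma>"
      unfolding V_def by (metis divide_pos_pos less_eq_real_def mult_left_le mult_nonneg_nonneg)
  qed
  moreover have "concave_on {0..} V"
    unfolding V_def using pos by (intro exponential_concave) simp
  ultimately show ?thesis
    using C2 unfolding concave_C2_bounded_HJB_solution_def V_def by blast
qed

section \<open>The slope at the origin\<close>

text \<open>The bound at \<open>\<beta>\<close> is the hypothesis \<open>M \<le> M_zero \<beta>\<close>; it is inherited by every smaller \<open>z\<close>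
  because \<open>z\<^sup>2 * (\<beta> * \<mu> - \<delta>) - \<beta>\<^sup>2 * (z * \<mu> - \<delta>) = (\<beta> - z) * (\<delta> * (z + \<beta>) - \<mu> * z * \<beta>)\<close>, whose
  second factor is nonnegative when \<open>z\<close> and \<open>\<beta>\<close> are at most \<open>2 * \<delta> / \<mu>\<close>.\<close>

lemma drift_bound_below:
  fixes \<mu> \<sigma> \<gamma> \<delta> M \<beta> z :: real
  assumes pos: "\<mu> > 0" "\<gamma> > 0" "M > 0" and z: "0 < z" "z \<le> \<beta>"
    and \<beta>: "\<beta> \<le> \<delta> / \<mu> \<or>
         (\<delta> / \<mu> < \<beta> \<and> \<beta> \<le> 2 * \<delta> / \<mu> \<and> M \<le> M_zero \<mu> \<sigma> \<gamma> \<delta> \<beta>)"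
  shows "(z * \<mu> - \<delta>) * M \<le> \<sigma>\<^sup>2 * z\<^sup>2 * \<gamma> / 2"
proof (cases "z * \<mu> \<le> \<delta>")
  case True
  then have "(z * \<mu> - \<delta>) * M \<le> 0"
    using pos by (simp add: mult_nonpos_nonneg)
  also have "0 \<le> \<sigma>\<^sup>2 * z\<^sup>2 * \<gamma> / 2"
    using pos by simp
  finally show ?thesis .
next
  case False
  have z\<beta>: "z * \<mu> \<le> \<beta> * \<mu>"
    using z pos by simp
  with False have \<delta>\<beta>: "\<beta> * \<mu> > \<delta>"
    by simp
  then have "\<not> \<beta> \<le> \<delta> / \<mu>"
    using pos by (simp add: field_simps)
  with \<beta> have two: "\<beta> * \<mu> \<le> 2 * \<delta>" and "M \<le> M_zero \<mu> \<sigma> \<gamma> \<delta> \<beta>"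
    using pos by (auto simp: field_simps)
  then have at_\<beta>: "(\<beta> * \<mu> - \<delta>) * M \<le> \<sigma>\<^sup>2 * \<beta>\<^sup>2 * \<gamma> / 2"
    using \<delta>\<beta> by (simp add: M_zero_def field_simps)
  have "z * (\<beta> * \<mu>) \<le> z * (2 * \<delta>)" "\<beta> * (z * \<mu>) \<le> \<beta> * (2 * \<delta>)"
    using two z z\<beta> by (auto intro!: mult_left_mono)
  then have "0 \<le> \<delta> * (z + \<beta>) - \<mu> * z * \<beta>"
    by (simp add: algebra_simps)
  then have "0 \<le> (\<beta> - z) * (\<delta> * (z + \<beta>) - \<mu> * z * \<beta>)"
    using z by (intro mult_nonneg_nonneg) auto
  then have mono: "\<beta>\<^sup>2 * (z * \<mu> - \<delta>) \<le> z\<^sup>2 * (\<beta> * \<mu> - \<delta>)"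
    by (simp add: algebra_simps power2_eq_square)
  have "(\<beta> * \<mu> - \<delta>) * ((z * \<mu> - \<delta>) * M) \<le> (z * \<mu> - \<delta>) * (\<sigma>\<^sup>2 * \<beta>\<^sup>2 * \<gamma> / 2)"
    using mult_left_mono[OF at_\<beta>, of "z * \<mu> - \<delta>"] False by (simp add: mult.left_commute)
  also have "\<dots> = \<sigma>\<^sup>2 * \<gamma> / 2 * (\<beta>\<^sup>2 * (z * \<mu> - \<delta>))"
    by simp
  also have "\<dots> \<le> \<sigma>\<^sup>2 * \<gamma> / 2 * (z\<^sup>2 * (\<beta> * \<mu> - \<delta>))"
    using mono pos by (intro mult_left_mono) auto
  also have "\<dots> = (\<beta> * \<mu> - \<delta>) * (\<sigma>\<^sup>2 * z\<^sup>2 * \<gamma> / 2)"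
    by simp
  finally show ?thesis
    using \<delta>\<beta> by simp
qed

text \<open>If \<open>- M * r\<close> exceeded \<open>\<gamma>\<close>, then dividing \<open>P z = 0\<close> by \<open>- r\<close> would give
  \<open>- \<sigma>\<^sup>2 * z\<^sup>2 * r / 2 < z * \<mu> - \<delta>\<close>, and multiplying by \<open>M\<close> and using
  \<open>- M * r > \<gamma>\<close> once more would contradict the bound on \<open>(z * \<mu> - \<delta>) * M\<close>.\<close>

lemma slope_bound:
  fixes \<mu> \<sigma> \<gamma> \<delta> M r z :: real
  assumes pos: "M > 0" and r: "r < 0"
    and root: "1/2 * \<sigma>\<^sup>2 * z\<^sup>2 * r\<^sup>2 + (z * \<mu> - \<delta> - M) * r - \<gamma> = 0"
    and drift: "(z * \<mu> - \<delta>) * M \<le> \<sigma>\<^sup>2 * z\<^sup>2 * \<gamma> / 2"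
  shows "- M * r \<le> \<gamma>"
proof (rule ccontr)
  assume "\<not> - M * r \<le> \<gamma>"
  then have gt: "\<gamma> < - M * r"
    by simp
  have "(- r) * (z * \<mu> - \<delta>) = (- r) * (- (1/2 * \<sigma>\<^sup>2 * z\<^sup>2 * r)) + (- M * r - \<gamma>)"
    using root by (simp add: algebra_simps power2_eq_square)
  with gt have "(- r) * (- (1/2 * \<sigma>\<^sup>2 * z\<^sup>2 * r)) < (- r) * (z * \<mu> - \<delta>)"
    by linarith
  then have "- (1/2 * \<sigma>\<^sup>2 * z\<^sup>2 * r) < z * \<mu> - \<delta>"
    using r by (metis mult_less_cancel_left_pos neg_0_less_iff_less)
  then have "- (1/2 * \<sigma>\<^sup>2 * z\<^sup>2 * r) * M < (z * \<mu> - \<delta>) * M"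
    using pos by (rule mult_strict_right_mono)
  moreover have "1/2 * \<sigma>\<^sup>2 * z\<^sup>2 * \<gamma> \<le> 1/2 * \<sigma>\<^sup>2 * z\<^sup>2 * (- M * r)"
    using gt by (intro mult_left_mono) auto
  ultimately show False
    using drift by (simp add: algebra_simps)
qed

section \<open>The position of the vertex\<close>

lemma r_minus_neg:
  assumes "\<sigma> > 0" "\<gamma> > 0" "z > 0"
  shows "r_minus \<mu> \<sigma> \<gamma> \<delta> M z < 0"
proof -
  define b where "b = z * \<mu> - \<delta> - M"
  have "b\<^sup>2 < b\<^sup>2 + 2 * \<gamma> * \<sigma>\<^sup>2 * z\<^sup>2"
    using assms by simp
  then have "sqrt (b\<^sup>2) < sqrt (b\<^sup>2 + 2 * \<gamma> * \<sigma>\<^sup>2 * z\<^sup>2)"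
    by (rule real_sqrt_less_mono)
  then have "- b - sqrt (b\<^sup>2 + 2 * \<gamma> * \<sigma>\<^sup>2 * z\<^sup>2) < 0"
    by simp
  moreover have "\<sigma>\<^sup>2 * z\<^sup>2 > 0"
    using assms by simp
  ultimately show ?thesis
    unfolding r_minus_def b_def by (rule divide_neg_pos)
qed

lemma r_minus_root:
  fixes \<mu> \<sigma> \<gamma> \<delta> M z :: real
  assumes "\<sigma> > 0" "\<gamma> > 0" "z > 0"
  defines "r \<equiv> r_minus \<mu> \<sigma> \<gamma> \<delta> M z"
  shows "1/2 * \<sigma>\<^sup>2 * z\<^sup>2 * r\<^sup>2 + (z * \<mu> - \<delta> - M) * r - \<gamma> = 0"
proof -
  define b where "b = z * \<mu> - \<delta> - M"
  define A where "A = \<sigma>\<^sup>2 * z\<^sup>2"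
  have A: "A > 0"
    using assms by (simp add: A_def)
  have "r = (- b - sqrt (b\<^sup>2 + 2 * \<gamma> * A)) / A"
    unfolding r_def r_minus_def b_def A_def by (simp add: mult.assoc)
  then have "A * r + b = - sqrt (b\<^sup>2 + 2 * \<gamma> * A)"
    using A by simp
  then have "(A * r + b)\<^sup>2 = b\<^sup>2 + 2 * \<gamma> * A"
    using A assms by simp
  then have "A * (1/2 * A * r\<^sup>2 + b * r - \<gamma>) = A * 0"
    by (simp add: power2_eq_square algebra_simps)
  then show ?thesis
    using A by (auto simp: A_def b_def mult.assoc)
qed

lemma M_threshold_le_iff:
  assumes "\<mu> > 0" "\<gamma> > 0"
  shows "M_threshold \<mu> \<sigma> \<gamma> \<delta> z \<le> M \<longleftrightarrow> z * (\<mu>\<^sup>2 + 2 * \<gamma> * \<sigma>\<^sup>2) \<le> 2 * \<mu> * (\<delta> + M)"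
proof -
  define D where "D = \<mu>\<^sup>2 + 2 * \<gamma> * \<sigma>\<^sup>2"
  have "D > 0"
    using assms by (simp add: D_def add_pos_nonneg)
  then have "M_threshold \<mu> \<sigma> \<gamma> \<delta> z = z * D / (2 * \<mu>) - \<delta>"
    using assms unfolding M_threshold_def D_def[symmetric] by (simp add: field_simps)
  moreover have "z * D / (2 * \<mu>) - \<delta> \<le> M \<longleftrightarrow> z * D \<le> 2 * \<mu> * (\<delta> + M)"
    using assms by (simp add: field_simps)
  ultimately show ?thesis
    by (simp add: D_def)
qed

text \<open>The equation \<open>P z = 0\<close> in terms of \<open>\<sigma>\<^sup>2 * r * z + \<mu>\<close>, the quantity whose sign tells, for
  \<open>r < 0\<close>, on which side of the vertex \<open>- \<mu> / (\<sigma>\<^sup>2 * r)\<close> the control \<open>z\<close> lies.\<close>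

lemma root_completed_square:
  fixes \<mu> \<sigma> \<gamma> \<delta> M r z :: real
  assumes "1/2 * \<sigma>\<^sup>2 * z\<^sup>2 * r\<^sup>2 + (z * \<mu> - \<delta> - M) * r - \<gamma> = 0"
  shows "z * (\<sigma>\<^sup>2 * r * z + \<mu>)\<^sup>2 = z * (\<mu>\<^sup>2 + 2 * \<gamma> * \<sigma>\<^sup>2) + 2 * (\<delta> + M) * (\<sigma>\<^sup>2 * r * z)"
proof -
  have "z * (\<sigma>\<^sup>2 * r * z + \<mu>)\<^sup>2 - (z * (\<mu>\<^sup>2 + 2 * \<gamma> * \<sigma>\<^sup>2) + 2 * (\<delta> + M) * (\<sigma>\<^sup>2 * r * z)) =
      2 * \<sigma>\<^sup>2 * z * (1/2 * \<sigma>\<^sup>2 * z\<^sup>2 * r\<^sup>2 + (z * \<mu> - \<delta> - M) * r - \<gamma>)"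
    by (simp add: power2_eq_square algebra_simps)
  then show ?thesis
    using assms by simp
qed

text \<open>If \<open>z\<close> were beyond the vertex, the right-hand side of the completed square would be
  negative.\<close>

lemma vertex_right_of_control:
  fixes \<mu> \<sigma> \<gamma> \<delta> M r z :: real
  assumes z: "z > 0"
    and \<delta>M: "\<delta> + M > 0"
    and root: "1/2 * \<sigma>\<^sup>2 * z\<^sup>2 * r\<^sup>2 + (z * \<mu> - \<delta> - M) * r - \<gamma> = 0"
    and thr: "z * (\<mu>\<^sup>2 + 2 * \<gamma> * \<sigma>\<^sup>2) \<le> 2 * \<mu> * (\<delta> + M)"
  shows "\<sigma>\<^sup>2 * r * z + \<mu> \<ge> 0"
proof (rule ccontr)
  assume "\<not> ?thesis"
  then have "2 * (\<delta> + M) * (\<sigma>\<^sup>2 * r * z) < 2 * (\<delta> + M) * (- \<mu>)"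
    using \<delta>M by (intro mult_strict_left_mono) auto
  then have "z * (\<sigma>\<^sup>2 * r * z + \<mu>)\<^sup>2 < 0"
    using root_completed_square[OF root] thr by (simp add: algebra_simps)
  then show False
    using z by (simp add: mult_less_0_iff)
qed

text \<open>With \<open>D = \<mu>\<^sup>2 + 2 * \<gamma> * \<sigma>\<^sup>2\<close> and \<open>y = \<sigma>\<^sup>2 * r * z < 0\<close>, the completed square and the threshold
  give \<open>\<mu> * (y + \<mu>)\<^sup>2 \<ge> D * (y + \<mu>)\<close>. If \<open>y + \<mu>\<close> were positive, this would yield
  \<open>y + \<mu> \<ge> D / \<mu> \<ge> \<mu>\<close>, contradicting \<open>y < 0\<close>.\<close>

lemma vertex_left_of_control:
  fixes \<mu> \<sigma> \<gamma> \<delta> M r z :: real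
  assumes pos: "\<mu> > 0" "\<sigma> > 0" "\<gamma> > 0" and z: "z > 0" and r: "r < 0"
    and root: "1/2 * \<sigma>\<^sup>2 * z\<^sup>2 * r\<^sup>2 + (z * \<mu> - \<delta> - M) * r - \<gamma> = 0"
    and thr: "2 * \<mu> * (\<delta> + M) \<le> z * (\<mu>\<^sup>2 + 2 * \<gamma> * \<sigma>\<^sup>2)"
  shows "\<sigma>\<^sup>2 * r * z + \<mu> \<le> 0"
proof (rule ccontr)
  assume "\<not> ?thesis"
  then have gt: "\<sigma>\<^sup>2 * r * z + \<mu> > 0"
    by simp
  define y where "y = \<sigma>\<^sup>2 * r * z"
  define D where "D = \<mu>\<^sup>2 + 2 * \<gamma> * \<sigma>\<^sup>2"
  have y: "y < 0"
    using pos z r by (simp add: y_def mult_less_0_iff)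
  have "\<mu> * (z * (y + \<mu>)\<^sup>2) = \<mu> * (z * D + 2 * (\<delta> + M) * y)"
    using root_completed_square[OF root] by (simp add: y_def D_def)
  also have "\<dots> = \<mu> * z * D + 2 * \<mu> * (\<delta> + M) * y"
    by (simp add: algebra_simps)
  also have "\<dots> \<ge> \<mu> * z * D + z * D * y"
    using mult_right_mono_neg[OF thr, of y] y by (simp add: D_def)
  finally have "z * (D * (y + \<mu>)) \<le> z * (\<mu> * (y + \<mu>) * (y + \<mu>))"
    by (simp add: algebra_simps power2_eq_square)
  then have "D \<le> \<mu> * (y + \<mu>)"
    using z gt by (simp add: y_def)
  moreover have "\<mu> * (y + \<mu>) < \<mu> * \<mu>"
    using y pos by simp
  moreover have "\<mu> * \<mu> \<le> D"
    using pos by (simp add: D_def power2_eq_square)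
  ultimately show False
    by linarith
qed

text \<open>Monotonicity of the parabola \<open>P\<close> on either side of its vertex, in the factorised form
  \<open>P a - P z = r * (a - z) * (\<sigma>\<^sup>2 * r * (a + z) / 2 + \<mu>)\<close>: the last factor is the average of
  \<open>\<sigma>\<^sup>2 * r * a + \<mu>\<close> and \<open>\<sigma>\<^sup>2 * r * z + \<mu>\<close>.\<close>

lemma quadratic_nonneg:
  fixes \<mu> \<sigma> \<gamma> \<delta> M r a z :: real
  assumes r: "r < 0"
    and root: "1/2 * \<sigma>\<^sup>2 * z\<^sup>2 * r\<^sup>2 + (z * \<mu> - \<delta> - M) * r - \<gamma> = 0"
    and sides: "a \<le> z \<and> \<sigma>\<^sup>2 * r * z + \<mu> \<ge> 0 \<or> z \<le> a \<and> \<sigma>\<^sup>2 * r * z + \<mu> \<le> 0"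
  shows "1/2 * \<sigma>\<^sup>2 * a\<^sup>2 * r\<^sup>2 + (a * \<mu> - \<delta> - M) * r - \<gamma> \<ge> 0"
proof -
  have avg: "\<sigma>\<^sup>2 * r * (a + z) / 2 + \<mu> = (\<sigma>\<^sup>2 * r * z + \<mu>) + \<sigma>\<^sup>2 * r / 2 * (a - z)"
    by (simp add: field_simps)
  have c: "\<sigma>\<^sup>2 * r / 2 \<le> 0"
    using r by (simp add: mult_nonneg_nonpos)
  have "(a - z) * (\<sigma>\<^sup>2 * r * (a + z) / 2 + \<mu>) \<le> 0"
    using sides
  proof (elim disjE conjE)
    assume "a \<le> z" "\<sigma>\<^sup>2 * r * z + \<mu> \<ge> 0"
    moreover from this c have "\<sigma>\<^sup>2 * r / 2 * (a - z) \<ge> 0"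
      by (intro mult_nonpos_nonpos) auto
    ultimately show ?thesis
      unfolding avg by (intro mult_nonpos_nonneg) auto
  next
    assume "z \<le> a" "\<sigma>\<^sup>2 * r * z + \<mu> \<le> 0"
    moreover from this c have "\<sigma>\<^sup>2 * r / 2 * (a - z) \<le> 0"
      by (intro mult_nonpos_nonneg) auto
    ultimately show ?thesis
      unfolding avg by (intro mult_nonneg_nonpos) auto
  qed
  then have "0 \<le> r * ((a - z) * (\<sigma>\<^sup>2 * r * (a + z) / 2 + \<mu>))"
    using r by (intro mult_nonpos_nonpos) auto
  also have "\<dots> = (1/2 * \<sigma>\<^sup>2 * a\<^sup>2 * r\<^sup>2 + (a * \<mu> - \<delta> - M) * r - \<gamma>)
      - (1/2 * \<sigma>\<^sup>2 * z\<^sup>2 * r\<^sup>2 + (z * \<mu> - \<delta> - M) * r - \<gamma>)"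
    by (simp add: power2_eq_square field_simps)
  finally show ?thesis
    using root by simp
qed

text \<open>The exponent for which the vertex is a zero of \<open>P\<close>: putting \<open>\<sigma>\<^sup>2 * r * c = - \<mu>\<close> into the
  completed square leaves \<open>c * D = 2 * \<mu> * (\<delta> + M)\<close>.\<close>

lemma c_tilde_root:
  fixes \<mu> \<sigma> \<gamma> \<delta> M :: real
  assumes pos: "\<mu> > 0" "\<sigma> > 0" "\<gamma> > 0" "\<delta> + M > 0"
  defines "c \<equiv> c_tilde \<mu> \<sigma> \<gamma> \<delta> M"
  defines "r \<equiv> - (\<mu> / (\<sigma>\<^sup>2 * c))"
  shows "c > 0" and "c * (\<mu>\<^sup>2 + 2 * \<gamma> * \<sigma>\<^sup>2) = 2 * \<mu> * (\<delta> + M)"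
    and "\<sigma>\<^sup>2 * r * c + \<mu> = 0"
    and "1/2 * \<sigma>\<^sup>2 * c\<^sup>2 * r\<^sup>2 + (c * \<mu> - \<delta> - M) * r - \<gamma> = 0"
proof -
  define D where "D = \<mu>\<^sup>2 + 2 * \<gamma> * \<sigma>\<^sup>2"
  have D: "D > 0"
    using pos by (simp add: D_def add_pos_pos)
  have c_eq: "c = 2 * \<mu> * (\<delta> + M) / D"
    by (simp add: c_def c_tilde_def D_def)
  show c: "c > 0"
    using pos D by (simp add: c_eq)
  show cD: "c * (\<mu>\<^sup>2 + 2 * \<gamma> * \<sigma>\<^sup>2) = 2 * \<mu> * (\<delta> + M)"
    using D unfolding D_def[symmetric] by (simp add: c_eq)
  show vertex: "\<sigma>\<^sup>2 * r * c + \<mu> = 0"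
    using pos c by (simp add: r_def)
  have vertex': "\<sigma>\<^sup>2 * c * r = - \<mu>"
    using vertex by (simp add: algebra_simps)
  have "2 * \<mu> * (1/2 * \<sigma>\<^sup>2 * c\<^sup>2 * r\<^sup>2 + (c * \<mu> - \<delta> - M) * r - \<gamma>) =
      \<mu> * (\<sigma>\<^sup>2 * c * r) * (c * r) + 2 * \<mu> * \<mu> * (c * r) - 2 * \<mu> * (\<delta> + M) * r - 2 * \<mu> * \<gamma>"
    by (simp add: power2_eq_square algebra_simps)
  also have "\<dots> = \<mu> * (- \<mu>) * (c * r) + 2 * \<mu> * \<mu> * (c * r)
      - c * (\<mu>\<^sup>2 + 2 * \<gamma> * \<sigma>\<^sup>2) * r - 2 * \<mu> * \<gamma>"
    unfolding cD vertex' by simp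
  also have "\<dots> = - 2 * \<gamma> * (\<sigma>\<^sup>2 * r * c + \<mu>)"
    by (simp add: power2_eq_square algebra_simps)
  also have "\<dots> = 0"
    using vertex by simp
  finally show "1/2 * \<sigma>\<^sup>2 * c\<^sup>2 * r\<^sup>2 + (c * \<mu> - \<delta> - M) * r - \<gamma> = 0"
    using pos by simp
qed

section \<open>The three regimes\<close>

theorem theorem3p19:
  fixes \<mu> \<sigma> \<gamma> \<delta> M \<alpha> \<beta> :: real
  assumes "\<mu> > 0" and "\<sigma> > 0" and "\<gamma> > 0" and "\<delta> \<ge> 0" and "M > 0"
    and "0 < \<alpha>" and "\<alpha> < \<beta>"
    and "\<beta> \<le> \<delta> / \<mu> \<or>
         (\<delta> / \<mu> < \<beta> \<and> \<beta> \<le> 2 * \<delta> / \<mu> \<and> M \<le> M_zero \<mu> \<sigma> \<gamma> \<delta> \<beta>)"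
  shows
    "(M \<ge> M_threshold \<mu> \<sigma> \<gamma> \<delta> \<beta> \<longrightarrow>
        concave_C2_bounded_HJB_solution \<mu> \<sigma> \<gamma> \<delta> M \<alpha> \<beta>
          (\<lambda>x. M / \<gamma> * (1 - exp (r_minus \<mu> \<sigma> \<gamma> \<delta> M \<beta> * x))))
     \<and> (M_threshold \<mu> \<sigma> \<gamma> \<delta> \<alpha> \<le> M \<and> M < M_threshold \<mu> \<sigma> \<gamma> \<delta> \<beta> \<longrightarrow>
        concave_C2_bounded_HJB_solution \<mu> \<sigma> \<gamma> \<delta> M \<alpha> \<beta>
          (\<lambda>x. M / \<gamma> * (1 - exp (- (\<mu> / (\<sigma>\<^sup>2 * c_tilde \<mu> \<sigma> \<gamma> \<delta> M)) * x))))
     \<and> (M < M_threshold \<mu> \<sigma> \<gamma> \<delta> \<alpha> \<longrightarrow>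
        concave_C2_bounded_HJB_solution \<mu> \<sigma> \<gamma> \<delta> M \<alpha> \<beta>
          (\<lambda>x. M / \<gamma> * (1 - exp (r_minus \<mu> \<sigma> \<gamma> \<delta> M \<alpha> * x))))"
proof -
  define D where "D = \<mu>\<^sup>2 + 2 * \<gamma> * \<sigma>\<^sup>2"
  have D: "D > 0"
    using assms by (simp add: D_def add_pos_pos)
  have threshold: "M_threshold \<mu> \<sigma> \<gamma> \<delta> z \<le> M \<longleftrightarrow> z * D \<le> 2 * \<mu> * (\<delta> + M)" for z
    unfolding D_def by (rule M_threshold_le_iff) (use assms in auto)
  have \<delta>M: "\<delta> + M > 0"
    using assms by simp
  \<comment> \<open>It suffices that \<open>z\<close> is a zero of \<open>P\<close> and the point of \<open>[\<alpha>, \<beta>]\<close> closest to the vertex.\<close>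
  have solution: "concave_C2_bounded_HJB_solution \<mu> \<sigma> \<gamma> \<delta> M \<alpha> \<beta> (\<lambda>x. M / \<gamma> * (1 - exp (r * x)))"
    if r: "r < 0" and z: "z \<in> {\<alpha>..\<beta>}"
      and root: "1/2 * \<sigma>\<^sup>2 * z\<^sup>2 * r\<^sup>2 + (z * \<mu> - \<delta> - M) * r - \<gamma> = 0"
      and sides: "\<And>a. a \<in> {\<alpha>..\<beta>} \<Longrightarrow>
        a \<le> z \<and> \<sigma>\<^sup>2 * r * z + \<mu> \<ge> 0 \<or> z \<le> a \<and> \<sigma>\<^sup>2 * r * z + \<mu> \<le> 0"
    for r z
  proof (rule exponential_solution[OF _ _ r _ z root])
    show "- M * r \<le> \<gamma>"
      using slope_bound[OF _ r root] drift_bound_below[of \<mu> \<gamma> M z \<beta> \<delta> \<sigma>] assms z by auto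
    show "1/2 * \<sigma>\<^sup>2 * a\<^sup>2 * r\<^sup>2 + (a * \<mu> - \<delta> - M) * r - \<gamma> \<ge> 0" if "a \<in> {\<alpha>..\<beta>}" for a
      by (rule quadratic_nonneg[OF r root sides[OF that]])
  qed (use assms in auto)

  show ?thesis
  proof (intro conjI impI)
    assume "M \<ge> M_threshold \<mu> \<sigma> \<gamma> \<delta> \<beta>"
    then have thr: "\<beta> * D \<le> 2 * \<mu> * (\<delta> + M)"
      by (simp add: threshold)
    have \<beta>: "\<beta> > 0"
      using assms by simp
    note root = r_minus_root[OF assms(2,3) \<beta>, of \<mu> \<delta> M]
    have "\<sigma>\<^sup>2 * r_minus \<mu> \<sigma> \<gamma> \<delta> M \<beta> * \<beta> + \<mu> \<ge> 0"
      by (rule vertex_right_of_control[OF \<beta> \<delta>M root thr[unfolded D_def]])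
    then show "concave_C2_bounded_HJB_solution \<mu> \<sigma> \<gamma> \<delta> M \<alpha> \<beta>
          (\<lambda>x. M / \<gamma> * (1 - exp (r_minus \<mu> \<sigma> \<gamma> \<delta> M \<beta> * x)))"
      using assms by (intro solution[OF r_minus_neg[OF assms(2,3) \<beta>] _ root]) auto
  next
    assume thr: "M_threshold \<mu> \<sigma> \<gamma> \<delta> \<alpha> \<le> M \<and> M < M_threshold \<mu> \<sigma> \<gamma> \<delta> \<beta>"
    define c where "c = c_tilde \<mu> \<sigma> \<gamma> \<delta> M"
    note c = c_tilde_root[OF assms(1,2,3) \<delta>M, folded c_def D_def]
    have "\<alpha> * D \<le> c * D" "c * D \<le> \<beta> * D"
      using thr threshold[of \<alpha>] threshold[of \<beta>] c(2) by auto
    then have "c \<in> {\<alpha>..\<beta>}"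
      using D by simp
    moreover have "- (\<mu> / (\<sigma>\<^sup>2 * c)) < 0"
      using assms c(1) by simp
    ultimately show "concave_C2_bounded_HJB_solution \<mu> \<sigma> \<gamma> \<delta> M \<alpha> \<beta>
          (\<lambda>x. M / \<gamma> * (1 - exp (- (\<mu> / (\<sigma>\<^sup>2 * c_tilde \<mu> \<sigma> \<gamma> \<delta> M)) * x)))"
      unfolding c_def[symmetric] using c(3) by (intro solution[OF _ _ c(4)]) auto
  next
    assume "M < M_threshold \<mu> \<sigma> \<gamma> \<delta> \<alpha>"
    then have thr: "2 * \<mu> * (\<delta> + M) \<le> \<alpha> * D"
      using threshold[of \<alpha>] by simp
    note root = r_minus_root[OF assms(2,3,6), of \<mu> \<delta> M]
    have "\<sigma>\<^sup>2 * r_minus \<mu> \<sigma> \<gamma> \<delta> M \<alpha> * \<alpha> + \<mu> \<le> 0"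
      by (rule vertex_left_of_control[OF assms(1,2,3,6) r_minus_neg[OF assms(2,3,6)] root
            thr[unfolded D_def]])
    then show "concave_C2_bounded_HJB_solution \<mu> \<sigma> \<gamma> \<delta> M \<alpha> \<beta>
          (\<lambda>x. M / \<gamma> * (1 - exp (r_minus \<mu> \<sigma> \<gamma> \<delta> M \<alpha> * x)))"
      using assms by (intro solution[OF r_minus_neg[OF assms(2,3,6)] _ root]) auto
  qed
qed

end
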